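(* Let $G$ be a Lie group with Lie algebra $\mathfrak{g}$, let $\mathsf{h}$ be a left-invariant Riemannian metric on $G$, and let $X\in\mathfrak{g}$ be a non-zero left-invariant vector field with $\|X\|=\sqrt{\mathsf{h}(X,X)}<1$. Let $F(x,y)=\sqrt{\mathsf{h}(y,y)}+\mathsf{h}(X(x),y)$ be the associated left-invariant Randers metric. Let $g_X$ be the left-invariant Riemannian metric $$g_X(v,z)=(1+\|X\|)\Big(\mathsf{h}(v,z)+\frac{1}{\|X\|}\mathsf{h}(X(x),v)\,\mathsf{h}(X(x),z)\Big),\qquad v,z\in T_xG,$$ assume $\sqrt{g_X(X,X)}<1$, and let $\tilde F(x,y)=\sqrt{g_X(y,y)}+g_X(X(x),y)$ be the associated left-invariant Randers metric. Then: \begin{enumerate} \item $F$ is of Douglas type if and only if $\tilde F$ is of Douglas type. \item $F$ is of Berwald type if and only if $\tilde F$ is of Berwald type. \end{enumerate}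
   Context: For a Finsler metric $F$ on a manifold $M$, let $g_{ij}(x,y)=\frac12\frac{\partial^2 F^2}{\partial y^i\partial y^j}$ be the fundamental tensor, with inverse $g^{ij}$, and let the spray coefficients in local coordinates be $G^i=\frac14 g^{il}\big([F^2]_{x^ky^l}y^k-[F^2]_{x^l}\big)$. $F$ is of Berwald type if in every local coordinate system each $G^i$ is quadratic in $y$, i.e. $G^i=\frac12\Gamma^i_{jk}(x)y^jy^k$. $F$ is of Douglas type if locally $G^i=\frac12\Gamma^i_{jk}(x)y^jy^k+P(x,y)y^i$, where $P$ is positively homogeneous of degree one in $y$. The metric $g_X$ is the fundamental tensor $g_y$ of $F$ evaluated at $y=X$. *)

theory Defs
  imports "HOL-Analysis.Analysis" "HOL-Algebra.Group"
begin

section \<open>Smooth functions on open subsets of normed spaces\<close>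

text \<open>Meant for an open set \<open>S\<close> in a finite-dimensional domain, where it is the usual
  class $C^k$.\<close>

fun Ck_on :: "nat \<Rightarrow> 'a::real_normed_vector set \<Rightarrow> ('a \<Rightarrow> 'b::real_normed_vector) \<Rightarrow> bool" where
  "Ck_on 0 S f \<longleftrightarrow> continuous_on S f"
| "Ck_on (Suc k) S f \<longleftrightarrow>
     (\<forall>x\<in>S. f differentiable (at x)) \<and> (\<forall>v. Ck_on k S (\<lambda>x. frechet_derivative f (at x) v))"

definition smooth_on :: "'a::real_normed_vector set \<Rightarrow> ('a \<Rightarrow> 'b::real_normed_vector) \<Rightarrow> bool" where
  "smooth_on S f \<longleftrightarrow> (\<forall>k. Ck_on k S f)"

definition partial :: "'n::finite \<Rightarrow> (real^'n \<Rightarrow> real) \<Rightarrow> real^'n \<Rightarrow> real" where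
  "partial i f x = frechet_derivative f (at x) (axis i 1)"


section \<open>Smooth manifolds\<close>

text \<open>The underlying set of a manifold is a whole type. A chart is a pair of its domain and its
  coordinate map; the values of the map outside the domain are irrelevant.\<close>

type_synonym ('g, 'n) chart = "'g set \<times> ('g \<Rightarrow> real^'n)"

abbreviation dom_of :: "('g, 'n::finite) chart \<Rightarrow> 'g set" where
  "dom_of c \<equiv> fst c"

abbreviation coord :: "('g, 'n::finite) chart \<Rightarrow> 'g \<Rightarrow> real^'n" where
  "coord c \<equiv> snd c"

abbreviation image_of :: "('g, 'n::finite) chart \<Rightarrow> (real^'n) set" where
  "image_of c \<equiv> coord c ` dom_of c"

abbreviation param :: "('g, 'n::finite) chart \<Rightarrow> real^'n \<Rightarrow> 'g" where
  "param c \<equiv> inv_into (dom_of c) (coord c)"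

definition is_chart :: "('g::topological_space, 'n::finite) chart \<Rightarrow> bool" where
  "is_chart c \<longleftrightarrow> open (dom_of c) \<and> open (image_of c) \<and>
     homeomorphism (dom_of c) (image_of c) (coord c) (param c)"

definition compatible :: "('g, 'n::finite) chart \<Rightarrow> ('g, 'n) chart \<Rightarrow> bool" where
  "compatible c d \<longleftrightarrow>
     smooth_on (coord c ` (dom_of c \<inter> dom_of d)) (coord d \<circ> param c) \<and>
     smooth_on (coord d ` (dom_of c \<inter> dom_of d)) (coord c \<circ> param d)"

text \<open>A smooth structure is a maximal atlas, so that its elements are all the local coordinate
  systems of the manifold.\<close>

definition smooth_structure :: "('g::topological_space, 'n::finite) chart set \<Rightarrow> bool" where
  "smooth_structure A \<longleftrightarrow>
     (\<forall>c\<in>A. is_chart c) \<and> (\<Union>c\<in>A. dom_of c) = UNIV \<and> (\<forall>c\<in>A. \<forall>d\<in>A. compatible c d) \<and>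
     (\<forall>c. is_chart c \<and> (\<forall>d\<in>A. compatible c d) \<longrightarrow> c \<in> A)"


section \<open>Tangent vectors\<close>

text \<open>A tangent vector at \<open>p\<close> is the family of its components in all charts around \<open>p\<close>, related
  by the Jacobians of the coordinate changes. The components at all other charts are set to \<open>0\<close>,
  so that a tangent vector is determined by its components in one chart around \<open>p\<close>.\<close>

type_synonym ('g, 'n) tvec = "('g, 'n) chart \<Rightarrow> real^'n"

definition tangent_space :: "('g, 'n::finite) chart set \<Rightarrow> 'g \<Rightarrow> ('g, 'n) tvec set" where
  "tangent_space A p = {v.
     (\<forall>c\<in>A. \<forall>d\<in>A. p \<in> dom_of c \<inter> dom_of d \<longrightarrow>
        v d = frechet_derivative (coord d \<circ> param c) (at (coord c p)) (v c)) \<and>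
     (\<forall>c. \<not> (c \<in> A \<and> p \<in> dom_of c) \<longrightarrow> v c = 0)}"

text \<open>The tangent vector $y^i \partial_i|_p$ of the chart \<open>c\<close>.\<close>

definition coord_vec ::
  "('g, 'n::finite) chart set \<Rightarrow> ('g, 'n) chart \<Rightarrow> 'g \<Rightarrow> real^'n \<Rightarrow> ('g, 'n) tvec" where
  "coord_vec A c p y = (\<lambda>d. if d \<in> A \<and> p \<in> dom_of d
     then frechet_derivative (coord d \<circ> param c) (at (coord c p)) y else 0)"

text \<open>The differential at \<open>p\<close> of a smooth self-map of the manifold. By the chain rule, it does not
  depend on the chart around \<open>p\<close> that is picked for computing it.\<close>

definition differential ::
  "('g, 'n::finite) chart set \<Rightarrow> ('g \<Rightarrow> 'g) \<Rightarrow> 'g \<Rightarrow> ('g, 'n) tvec \<Rightarrow> ('g, 'n) tvec" where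
  "differential A f p v = (let c = (SOME c. c \<in> A \<and> p \<in> dom_of c) in
     (\<lambda>d. if d \<in> A \<and> f p \<in> dom_of d
       then frechet_derivative (coord d \<circ> f \<circ> param c) (at (coord c p)) (v c) else 0))"

definition smooth_vector_field ::
  "('g, 'n::finite) chart set \<Rightarrow> ('g \<Rightarrow> ('g, 'n) tvec) \<Rightarrow> bool" where
  "smooth_vector_field A X \<longleftrightarrow>
     (\<forall>p. X p \<in> tangent_space A p) \<and>
     (\<forall>c\<in>A. smooth_on (image_of c) (\<lambda>x. X (param c x) c))"

definition riemannian_metric ::
  "('g, 'n::finite) chart set \<Rightarrow> ('g \<Rightarrow> ('g, 'n) tvec \<Rightarrow> ('g, 'n) tvec \<Rightarrow> real) \<Rightarrow> bool" where
  "riemannian_metric A h \<longleftrightarrow>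
     (\<forall>p. \<forall>u\<in>tangent_space A p. \<forall>v\<in>tangent_space A p. h p u v = h p v u) \<and>
     (\<forall>p. \<forall>u\<in>tangent_space A p. \<forall>v\<in>tangent_space A p. \<forall>w\<in>tangent_space A p. \<forall>a b.
        h p (\<lambda>c. a *\<^sub>R u c + b *\<^sub>R v c) w = a * h p u w + b * h p v w) \<and>
     (\<forall>p. \<forall>v\<in>tangent_space A p. v \<noteq> (\<lambda>c. 0) \<longrightarrow> h p v v > 0) \<and>
     (\<forall>c\<in>A. \<forall>i j. smooth_on (image_of c) (\<lambda>x.
        h (param c x) (coord_vec A c (param c x) (axis i 1))
                      (coord_vec A c (param c x) (axis j 1))))"


section \<open>Lie groups\<close>

text \<open>In the smoothness of the multiplication, the set of pairs whose product lies in
  the third chart domain is open because the multiplication is required to be continuous;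
  likewise for inversion.\<close>

definition lie_group ::
  "'g::{t2_space, second_countable_topology} monoid \<Rightarrow> ('g, 'n::finite) chart set \<Rightarrow> bool" where
  "lie_group G A \<longleftrightarrow>
     smooth_structure A \<and> group G \<and> carrier G = UNIV \<and>
     continuous_on UNIV (\<lambda>(a, b). a \<otimes>\<^bsub>G\<^esub> b) \<and>
     (\<forall>c\<in>A. \<forall>d\<in>A. \<forall>e\<in>A. smooth_on
        {(x, y). x \<in> image_of c \<and> y \<in> image_of d \<and> param c x \<otimes>\<^bsub>G\<^esub> param d y \<in> dom_of e}
        (\<lambda>(x, y). coord e (param c x \<otimes>\<^bsub>G\<^esub> param d y))) \<and>
     continuous_on UNIV (\<lambda>a. inv\<^bsub>G\<^esub> a) \<and>
     (\<forall>c\<in>A. \<forall>d\<in>A. smooth_on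
        {x. x \<in> image_of c \<and> inv\<^bsub>G\<^esub> (param c x) \<in> dom_of d}
        (\<lambda>x. coord d (inv\<^bsub>G\<^esub> (param c x))))"

text \<open>The Lie algebra, as the set of left-invariant vector fields.\<close>

definition lie_algebra ::
  "'g monoid \<Rightarrow> ('g, 'n::finite) chart set \<Rightarrow> ('g \<Rightarrow> ('g, 'n) tvec) set" where
  "lie_algebra G A = {X. smooth_vector_field A X \<and>
     (\<forall>a p. differential A (\<lambda>q. a \<otimes>\<^bsub>G\<^esub> q) p (X p) = X (a \<otimes>\<^bsub>G\<^esub> p))}"

definition left_invariant_metric ::
  "'g monoid \<Rightarrow> ('g, 'n::finite) chart set \<Rightarrow>
   ('g \<Rightarrow> ('g, 'n) tvec \<Rightarrow> ('g, 'n) tvec \<Rightarrow> real) \<Rightarrow> bool" where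
  "left_invariant_metric G A h \<longleftrightarrow>
     (\<forall>a p. \<forall>u\<in>tangent_space A p. \<forall>v\<in>tangent_space A p.
        h (a \<otimes>\<^bsub>G\<^esub> p) (differential A (\<lambda>q. a \<otimes>\<^bsub>G\<^esub> q) p u) (differential A (\<lambda>q. a \<otimes>\<^bsub>G\<^esub> q) p v)
          = h p u v)"


section \<open>Spray coefficients, Berwald and Douglas type\<close>

text \<open>\<open>local_rep A c F x y\<close> is $F(x,y)$ in the chart \<open>c\<close>, the vector \<open>y\<close> standing for
  $y^i \partial_i$.\<close>

definition local_rep ::
  "('g, 'n::finite) chart set \<Rightarrow> ('g, 'n) chart \<Rightarrow> ('g \<Rightarrow> ('g, 'n) tvec \<Rightarrow> real) \<Rightarrow>
   real^'n \<Rightarrow> real^'n \<Rightarrow> real" where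
  "local_rep A c F x y = F (param c x) (coord_vec A c (param c x) y)"

definition fundamental_tensor ::
  "(real^'n \<Rightarrow> real^'n \<Rightarrow> real) \<Rightarrow> real^'n \<Rightarrow> real^'n \<Rightarrow> real^'n::finite^'n" where
  "fundamental_tensor F x y =
     (\<chi> i j. 1/2 * partial i (\<lambda>u. partial j (\<lambda>w. (F x w)\<^sup>2) u) y)"

definition spray ::
  "(real^'n \<Rightarrow> real^'n \<Rightarrow> real) \<Rightarrow> 'n::finite \<Rightarrow> real^'n \<Rightarrow> real^'n \<Rightarrow> real" where
  "spray F i x y = 1/4 * (\<Sum>l\<in>UNIV. matrix_inv (fundamental_tensor F x y) $ i $ l *
     ((\<Sum>k\<in>UNIV. partial l (\<lambda>u. partial k (\<lambda>z. (F z u)\<^sup>2) x) y * y $ k)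
       - partial l (\<lambda>z. (F z y)\<^sup>2) x))"

text \<open>As usual in Finsler geometry, all conditions are on the slit tangent bundle \<open>y \<noteq> 0\<close>,
  since the fundamental tensor is not defined at \<open>y = 0\<close>.\<close>

definition berwald_type ::
  "('g, 'n::finite) chart set \<Rightarrow> ('g \<Rightarrow> ('g, 'n) tvec \<Rightarrow> real) \<Rightarrow> bool" where
  "berwald_type A F \<longleftrightarrow> (\<forall>c\<in>A. \<exists>\<Gamma> :: 'n \<Rightarrow> 'n \<Rightarrow> 'n \<Rightarrow> real^'n \<Rightarrow> real.
     \<forall>x\<in>image_of c. \<forall>y. y \<noteq> 0 \<longrightarrow> (\<forall>i.
       spray (local_rep A c F) i x y =
         1/2 * (\<Sum>j\<in>UNIV. \<Sum>k\<in>UNIV. \<Gamma> i j k x * y $ j * y $ k)))"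

definition douglas_type ::
  "('g, 'n::finite) chart set \<Rightarrow> ('g \<Rightarrow> ('g, 'n) tvec \<Rightarrow> real) \<Rightarrow> bool" where
  "douglas_type A F \<longleftrightarrow> (\<forall>c\<in>A. \<exists>(\<Gamma> :: 'n \<Rightarrow> 'n \<Rightarrow> 'n \<Rightarrow> real^'n \<Rightarrow> real) (P :: real^'n \<Rightarrow> real^'n \<Rightarrow> real).
     (\<forall>x\<in>image_of c. \<forall>y. y \<noteq> 0 \<longrightarrow> (\<forall>t>0. P x (t *\<^sub>R y) = t * P x y)) \<and>
     (\<forall>x\<in>image_of c. \<forall>y. y \<noteq> 0 \<longrightarrow> (\<forall>i.
       spray (local_rep A c F) i x y =
         1/2 * (\<Sum>j\<in>UNIV. \<Sum>k\<in>UNIV. \<Gamma> i j k x * y $ j * y $ k) + P x y * y $ i)))"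


section \<open>Randers metrics\<close>

definition norm_wrt ::
  "('g \<Rightarrow> ('g, 'n) tvec \<Rightarrow> ('g, 'n) tvec \<Rightarrow> real) \<Rightarrow> 'g \<Rightarrow> ('g, 'n::finite) tvec \<Rightarrow> real" where
  "norm_wrt h p v = sqrt (h p v v)"

definition randers ::
  "('g \<Rightarrow> ('g, 'n::finite) tvec \<Rightarrow> ('g, 'n) tvec \<Rightarrow> real) \<Rightarrow> ('g \<Rightarrow> ('g, 'n) tvec) \<Rightarrow>
   'g \<Rightarrow> ('g, 'n) tvec \<Rightarrow> real" where
  "randers h X p y = sqrt (h p y y) + h p (X p) y"

text \<open>The osculating metric $g_X$, i.e. the fundamental tensor of \<open>randers h X\<close> at $y = X$.
  For left-invariant \<open>h\<close> and \<open>X\<close> the norm of \<open>X p\<close> does not depend on the point \<open>p\<close>.\<close>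

definition osc_metric ::
  "('g \<Rightarrow> ('g, 'n::finite) tvec \<Rightarrow> ('g, 'n) tvec \<Rightarrow> real) \<Rightarrow> ('g \<Rightarrow> ('g, 'n) tvec) \<Rightarrow>
   'g \<Rightarrow> ('g, 'n) tvec \<Rightarrow> ('g, 'n) tvec \<Rightarrow> real" where
  "osc_metric h X p v z = (1 + norm_wrt h p (X p)) *
     (h p v z + 1 / norm_wrt h p (X p) * h p (X p) v * h p (X p) z)"

end

theory Submission
  imports Defs
begin

text \<open>In a chart write $F = \alpha + \beta$ with $\alpha = \sqrt{a_{ij} y^i y^j}$ and
  $\beta = b_i y^i$. Two criteria reduce the claim to linear algebra with first derivatives:
  $F$ is of Douglas type iff $\beta$ is closed (\<open>douglas_at_iff_closed\<close>), and of Berwald type iff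
  $\beta$ is parallel for $\alpha$ (\<open>berwald_at_iff_parallel\<close>). Both are read off from the formula
  \<open>spray_eq\<close>,
  $$2 G^i = 2 G^i_\alpha + \alpha\, S^i + \mu\, y^i,$$
  where $G_\alpha$ is the spray of $\alpha$, $S$ is $d\beta(y, \cdot)$ with the index raised, and
  $\mu$ is a scalar. The first term is even and quadratic in $y$, the second is odd and orthogonal
  to $y$. Comparing the values at $y$ and $-y$ therefore gives $S = 0$ as soon as $G$ is quadratic
  up to a multiple of $y$. Once $S = 0$, the function $\mu F$ is the covariant derivative
  $b_{i|j} y^i y^j$, which is even; if $\mu$ is moreover odd, this says
  $\mu(y)\,(F(y) + F(-y)) = 0$, whence $\mu = 0$.

  The formula is proved without inverting the fundamental tensor: its right-hand side solves the
  linear equations that define the spray, and these have only one solution because the fundamental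
  tensor is nondegenerate where $F > 0$ (\<open>g_nondegenerate\<close>).

  Left translations preserve $N = \|X\|$ and are transitive, so that $N$ is a positive constant
  (\<open>left_invariant_norm_constant\<close>). With $c = 1 + N$ the osculating metric and its one-form are
  $$\tilde a = c\,(a + \beta \otimes \beta / N), \qquad \tilde\beta = \tilde a(X, \cdot) = c^2 \beta,$$
  because $\beta(X) = N^2$. Hence one form is closed iff the other is, and if one of them is
  parallel for its metric, then both metrics are parallel for the same Levi-Civita connection, so
  that the other form is parallel as well; \<open>osculating_same_type\<close> computes this directly. The
  hypothesis $\sqrt{g_X(X,X)} < 1$ is $cN < 1$, the condition under which the second Randers metric
  is positive.\<close>

section \<open>Linear algebra in coordinates\<close>

lemma linear_axis_expansion:
  fixes f :: "real^'n \<Rightarrow> 'b::real_vector"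
  assumes "linear f"
  shows "f y = (\<Sum>j\<in>UNIV. y $ j *\<^sub>R f (axis j 1))"
proof -
  have "f y = f (\<Sum>j\<in>UNIV. y $ j *\<^sub>R axis j 1)"
    using basis_expansion[of y] by (simp add: scalar_mult_eq_scaleR)
  then show ?thesis
    by (simp add: linear_sum[OF assms] linear_scale[OF assms])
qed

lemma bilinear_axis_expansion:
  fixes f :: "real^'n \<Rightarrow> real^'m \<Rightarrow> 'b::real_vector"
  assumes "bilinear f"
  shows "f u v = (\<Sum>j\<in>UNIV. \<Sum>k\<in>UNIV. (u $ j * v $ k) *\<^sub>R f (axis j 1) (axis k 1))"
proof -
  have l1: "linear (\<lambda>u. f u v)" and l2: "\<And>u. linear (\<lambda>v. f u v)" for v
    using assms by (auto simp: bilinear_def)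
  show ?thesis
    by (subst linear_axis_expansion[OF l1], subst linear_axis_expansion[OF l2])
       (simp add: scaleR_sum_right)
qed

lemma matrix_inv_mult_left:
  fixes M :: "real^'n^'n"
  assumes "invertible M"
  shows "matrix_inv M ** M = mat 1"
  using assms unfolding invertible_def matrix_inv_def by (rule someI2_ex) blast

lemma bilinear_diag_has_derivative:
  fixes B :: "real^'n \<Rightarrow> real^'n \<Rightarrow> real"
  assumes "bilinear B" and "\<And>u v. B u v = B v u"
  shows "((\<lambda>u. B u u) has_derivative (\<lambda>w. 2 * B y w)) (at y)"
proof -
  have bb: "bounded_bilinear B"
    using assms(1) bilinear_conv_bounded_bilinear by blast
  have "((\<lambda>u. B u u) has_derivative (\<lambda>w. B y w + B w y)) (at y)"
    by (rule bounded_bilinear.FDERIV[OF bb has_derivative_ident has_derivative_ident])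
  moreover have "B y w + B w y = 2 * B y w" for w
    using assms(2)[of w y] by simp
  ultimately show ?thesis
    by simp
qed

lemma linear_has_derivative:
  fixes f :: "real^'n \<Rightarrow> 'b::real_normed_vector"
  assumes "linear f"
  shows "(f has_derivative f) (at y)"
  using assms linear_conv_bounded_linear bounded_linear_imp_has_derivative by blast

lemma partial_eq:
  assumes "(f has_derivative D) (at x)"
  shows "partial i f x = D (axis i 1)"
  using frechet_derivative_at[OF assms] by (simp add: partial_def)

section \<open>The spray of a Randers metric at a point\<close>

definition berwald_at :: "(real^'n \<Rightarrow> real^'n \<Rightarrow> real) \<Rightarrow> real^'n::finite \<Rightarrow> bool" where
  "berwald_at F x \<longleftrightarrow> (\<exists>\<Gamma> :: 'n \<Rightarrow> 'n \<Rightarrow> 'n \<Rightarrow> real. \<forall>y. y \<noteq> 0 \<longrightarrow> (\<forall>i.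
     spray F i x y = 1/2 * (\<Sum>j\<in>UNIV. \<Sum>k\<in>UNIV. \<Gamma> i j k * y $ j * y $ k)))"

definition douglas_at :: "(real^'n \<Rightarrow> real^'n \<Rightarrow> real) \<Rightarrow> real^'n::finite \<Rightarrow> bool" where
  "douglas_at F x \<longleftrightarrow> (\<exists>(\<Gamma> :: 'n \<Rightarrow> 'n \<Rightarrow> 'n \<Rightarrow> real) P.
     (\<forall>y. y \<noteq> 0 \<longrightarrow> (\<forall>t>0. P (t *\<^sub>R y) = t * P y)) \<and>
     (\<forall>y. y \<noteq> 0 \<longrightarrow> (\<forall>i.
       spray F i x y = 1/2 * (\<Sum>j\<in>UNIV. \<Sum>k\<in>UNIV. \<Gamma> i j k * y $ j * y $ k) + P y * y $ i)))"

text \<open>The coefficients in the definitions of both types are arbitrary functions of the base point,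
  so that they can be chosen point by point.\<close>

lemma bchoice_coefficients_and_factor:
  "(\<exists>\<Gamma> P. \<forall>x\<in>I. Q x (\<lambda>i j k. \<Gamma> i j k x) (P x)) \<longleftrightarrow> (\<forall>x\<in>I. \<exists>\<Gamma> P. Q x \<Gamma> P)"
proof
  assume "\<forall>x\<in>I. \<exists>\<Gamma> P. Q x \<Gamma> P"
  then obtain \<Gamma> P where "\<forall>x\<in>I. Q x (\<Gamma> x) (P x)" by metis
  then show "\<exists>\<Gamma> P. \<forall>x\<in>I. Q x (\<lambda>i j k. \<Gamma> i j k x) (P x)"
    by (intro exI[of _ "\<lambda>i j k x. \<Gamma> x i j k"] exI[of _ P])
qed blast

lemma bchoice_coefficients:
  "(\<exists>\<Gamma>. \<forall>x\<in>I. Q x (\<lambda>i j k. \<Gamma> i j k x)) \<longleftrightarrow> (\<forall>x\<in>I. \<exists>\<Gamma>. Q x \<Gamma>)"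
  using bchoice_coefficients_and_factor[of I "\<lambda>x \<Gamma> P. Q x \<Gamma>"] by simp

lemma berwald_type_iff_pointwise:
  "berwald_type A F \<longleftrightarrow> (\<forall>c\<in>A. \<forall>x\<in>image_of c. berwald_at (local_rep A c F) x)"
  unfolding berwald_type_def berwald_at_def
  by (rule ball_cong[OF refl], rule bchoice_coefficients)

lemma douglas_type_iff_pointwise:
  "douglas_type A F \<longleftrightarrow> (\<forall>c\<in>A. \<forall>x\<in>image_of c. douglas_at (local_rep A c F) x)"
  unfolding douglas_type_def douglas_at_def ball_conj_distrib[symmetric]
  by (rule ball_cong[OF refl], rule bchoice_coefficients_and_factor)

lemma berwald_at_imp_douglas_at:
  assumes "berwald_at F x"
  shows "douglas_at F x"
proof -
  obtain \<Gamma> where "\<forall>y. y \<noteq> 0 \<longrightarrow> (\<forall>i.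
      spray F i x y = 1/2 * (\<Sum>j\<in>UNIV. \<Sum>k\<in>UNIV. \<Gamma> i j k * y $ j * y $ k))"
    using assms unfolding berwald_at_def by blast
  then show ?thesis
    unfolding douglas_at_def by (intro exI[of _ \<Gamma>] exI[of _ "\<lambda>y. 0"]) simp
qed

text \<open>The data of the locale are a Riemannian metric \<open>B\<close> and a one-form \<open>\<beta>\<close> on the open set \<open>U\<close>,
  the latter dual to the vector \<open>\<xi>\<close> at \<open>x\<close>, with their derivatives \<open>B' w\<close>, \<open>\<beta>' w\<close> at \<open>x\<close> in
  direction \<open>w\<close>. One derivative at the single point \<open>x\<close> is all that the spray at \<open>x\<close> involves.\<close>

locale randers_germ =
  fixes U :: "(real^'n::finite) set" and x :: "real^'n"
    and B B' :: "real^'n \<Rightarrow> real^'n \<Rightarrow> real^'n \<Rightarrow> real"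
    and \<beta> \<beta>' :: "real^'n \<Rightarrow> real^'n \<Rightarrow> real"
    and \<xi> :: "real^'n" and F :: "real^'n \<Rightarrow> real^'n \<Rightarrow> real"
  assumes openU: "open U" and xU: "x \<in> U"
    and bilin: "z \<in> U \<Longrightarrow> bilinear (B z)"
    and sym: "z \<in> U \<Longrightarrow> B z u v = B z v u"
    and pos: "u \<noteq> 0 \<Longrightarrow> B x u u > 0"
    and lin: "z \<in> U \<Longrightarrow> linear (\<beta> z)"
    and dB: "((\<lambda>z. B z u v) has_derivative (\<lambda>w. B' w u v)) (at x)"
    and d\<beta>: "((\<lambda>z. \<beta> z u) has_derivative (\<lambda>w. \<beta>' w u)) (at x)"
    and \<beta>_xi: "\<beta> x u = B x \<xi> u"
    and xi_small: "B x \<xi> \<xi> < 1"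
    and F_eq: "z \<in> U \<Longrightarrow> F z u = sqrt (B z u u) + \<beta> z u"
begin

definition \<alpha> :: "real^'n \<Rightarrow> real" where
  "\<alpha> u = sqrt (B x u u)"

lemma B_simps [simp]:
  "B x (u + v) w = B x u w + B x v w" "B x w (u + v) = B x w u + B x w v"
  "B x (u - v) w = B x u w - B x v w" "B x w (u - v) = B x w u - B x w v"
  "B x (r *\<^sub>R u) w = r * B x u w" "B x w (r *\<^sub>R u) = r * B x w u"
  "B x (- u) w = - B x u w" "B x w (- u) = - B x w u"
  "B x 0 w = 0" "B x w 0 = 0"
  using bilin[OF xU, THEN bilinear_ladd] bilin[OF xU, THEN bilinear_radd]
    bilin[OF xU, THEN bilinear_lsub] bilin[OF xU, THEN bilinear_rsub]
    bilin[OF xU, THEN bilinear_lmul] bilin[OF xU, THEN bilinear_rmul]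
    bilin[OF xU, THEN bilinear_lneg] bilin[OF xU, THEN bilinear_rneg]
    bilin[OF xU, THEN bilinear_lzero] bilin[OF xU, THEN bilinear_rzero]
  by simp_all

lemma \<beta>_simps [simp]:
  "\<beta> x (u + v) = \<beta> x u + \<beta> x v" "\<beta> x (r *\<^sub>R u) = r * \<beta> x u" "\<beta> x (- u) = - \<beta> x u"
  by (simp_all add: \<beta>_xi)

text \<open>Differentiation at \<open>x\<close> inherits the algebraic laws of the family, because they hold
  throughout the neighbourhood \<open>U\<close> of \<open>x\<close> and derivatives are unique.\<close>

lemma derivative_unique_near:
  fixes f g :: "real^'n \<Rightarrow> real"
  assumes "(f has_derivative f') (at x)" "(g has_derivative g') (at x)" "\<And>z. z \<in> U \<Longrightarrow> f z = g z"
  shows "f' w = g' w"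
proof -
  have "(g has_derivative f') (at x)"
    using has_derivative_transform_within_open[OF assms(1) openU xU assms(3)] by simp
  then show ?thesis
    using assms(2) has_derivative_unique by metis
qed

lemma B'_sym: "B' w u v = B' w v u"
  by (rule derivative_unique_near[OF dB dB]) (rule sym)

lemma B'_add2: "B' w (u + v) t = B' w u t + B' w v t"
  by (rule derivative_unique_near[OF dB has_derivative_add[OF dB dB]])
     (rule bilinear_ladd[OF bilin])

lemma B'_scale2: "B' w (r *\<^sub>R u) t = r * B' w u t"
  by (rule derivative_unique_near[OF dB has_derivative_mult_right[OF dB]])
     (simp add: bilinear_lmul[OF bilin])

lemma B'_linear1: "linear (\<lambda>w. B' w u v)"
  using dB has_derivative_linear by blast

lemma B'_simps [simp]:
  "B' w (u + v) t = B' w u t + B' w v t" "B' w t (u + v) = B' w t u + B' w t v"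
  "B' (u + v) w t = B' u w t + B' v w t"
  "B' w (r *\<^sub>R u) t = r * B' w u t" "B' w t (r *\<^sub>R u) = r * B' w t u"
  "B' (r *\<^sub>R u) w t = r * B' u w t"
proof -
  show "B' w t (u + v) = B' w t u + B' w t v" "B' w t (r *\<^sub>R u) = r * B' w t u"
    using B'_add2[of w u v t] B'_scale2[of w r u t] by (simp_all add: B'_sym[of w t])
qed (simp_all add: B'_add2 B'_scale2 linear_add[OF B'_linear1] linear_scale[OF B'_linear1])

lemma \<beta>'_simps [simp]:
  "\<beta>' w (u + v) = \<beta>' w u + \<beta>' w v" "\<beta>' (u + v) w = \<beta>' u w + \<beta>' v w"
  "\<beta>' w (r *\<^sub>R u) = r * \<beta>' w u" "\<beta>' (r *\<^sub>R u) w = r * \<beta>' u w"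
proof -
  show "\<beta>' w (u + v) = \<beta>' w u + \<beta>' w v"
    by (rule derivative_unique_near[OF d\<beta> has_derivative_add[OF d\<beta> d\<beta>]])
       (rule linear_add[OF lin])
  show "\<beta>' w (r *\<^sub>R u) = r * \<beta>' w u"
    by (rule derivative_unique_near[OF d\<beta> has_derivative_mult_right[OF d\<beta>]])
       (simp add: linear_scale[OF lin])
  have l: "linear (\<lambda>w. \<beta>' w u)" for u
    using d\<beta> has_derivative_linear by blast
  show "\<beta>' (u + v) w = \<beta>' u w + \<beta>' v w" "\<beta>' (r *\<^sub>R u) w = r * \<beta>' u w"
    using linear_add[OF l] linear_scale[OF l] by simp_all
qed

lemma minus_simps [simp]:
  "B' w (- u) t = - B' w u t" "B' w t (- u) = - B' w t u" "B' (- u) w t = - B' u w t"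
  "\<beta>' w (- u) = - \<beta>' w u" "\<beta>' (- u) w = - \<beta>' u w"
  using B'_simps(4-6)[where r="-1"] \<beta>'_simps(3,4)[where r="-1"] by simp_all

lemma \<alpha>_pos: "u \<noteq> 0 \<Longrightarrow> \<alpha> u > 0"
  by (simp add: \<alpha>_def pos)

lemma \<alpha>_square: "B x u u = \<alpha> u * \<alpha> u"
proof -
  have "B x u u \<ge> 0"
    using pos[of u] by (cases "u = 0") auto
  then show ?thesis
    by (simp add: \<alpha>_def)
qed

lemma \<alpha>_minus: "\<alpha> (- u) = \<alpha> u"
  by (simp add: \<alpha>_def)

lemma \<alpha>_scale: "t > 0 \<Longrightarrow> \<alpha> (t *\<^sub>R u) = t * \<alpha> u"
  by (simp add: \<alpha>_def real_sqrt_mult)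

lemma F_x: "F x u = \<alpha> u + \<beta> x u"
  using F_eq[OF xU] by (simp add: \<alpha>_def)

text \<open>This is the Cauchy--Schwarz inequality for \<open>B x\<close>: evaluating the form on
  $B(u,u)\,\xi - B(\xi,u)\,u$ gives $B(u,u)\,(B(\xi,\xi) B(u,u) - B(\xi,u)^2) \ge 0$.\<close>

lemma \<beta>_lt_\<alpha>:
  assumes "u \<noteq> 0"
  shows "\<bar>\<beta> x u\<bar> < \<alpha> u"
proof -
  let ?q = "B x u u" and ?t = "B x \<xi> u"
  have q: "?q > 0" using pos[OF assms] .
  let ?z = "?q *\<^sub>R \<xi> - ?t *\<^sub>R u"
  have "B x ?z ?z \<ge> 0" by (simp only: \<alpha>_square) simp
  moreover have "B x ?z ?z = ?q * (?q * B x \<xi> \<xi> - ?t\<^sup>2)"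
    by (simp add: sym[OF xU, of u \<xi>] algebra_simps power2_eq_square)
  ultimately have "?t\<^sup>2 \<le> ?q * B x \<xi> \<xi>"
    using q by (simp add: zero_le_mult_iff)
  also have "\<dots> < ?q" using q xi_small by simp
  finally have "sqrt (?t\<^sup>2) < sqrt ?q" by (rule real_sqrt_less_mono)
  then show ?thesis
    unfolding \<beta>_xi \<alpha>_def real_sqrt_abs .
qed

lemma F_pos: "u \<noteq> 0 \<Longrightarrow> F x u > 0"
  using \<beta>_lt_\<alpha>[of u] by (simp add: F_x)

subsection \<open>The fundamental tensor\<close>

lemma \<alpha>_has_derivative:
  assumes "y \<noteq> 0"
  shows "(\<alpha> has_derivative (\<lambda>w. B x y w / \<alpha> y)) (at y)"
proof -
  have "((\<lambda>u. sqrt (B x u u)) has_derivative (\<lambda>w. B x y w / sqrt (B x y y))) (at y)"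
    using pos[OF assms] \<alpha>_pos[OF assms]
    by (auto intro!: derivative_eq_intros bilinear_diag_has_derivative bilin xU sym
        simp: field_simps)
  then show ?thesis unfolding \<alpha>_def .
qed

text \<open>The derivative of \<open>F x\<close> at \<open>y\<close> in direction \<open>w\<close>.\<close>

definition Fy :: "real^'n \<Rightarrow> real^'n \<Rightarrow> real" where
  "Fy y w = B x y w / \<alpha> y + \<beta> x w"

lemma Fy_simps:
  "Fy y (u + v) = Fy y u + Fy y v" "Fy y (r *\<^sub>R u) = r * Fy y u"
  by (simp_all add: Fy_def add_divide_distrib distrib_left)

lemma Fy_self: "y \<noteq> 0 \<Longrightarrow> Fy y y = F x y"
  using \<alpha>_pos[of y] by (simp add: Fy_def F_x \<alpha>_square)

lemma F_has_derivative:
  assumes "y \<noteq> 0"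
  shows "(F x has_derivative Fy y) (at y)"
proof -
  have "((\<lambda>u. \<alpha> u + \<beta> x u) has_derivative (\<lambda>w. B x y w / \<alpha> y + \<beta> x w)) (at y)"
    by (rule has_derivative_add[OF \<alpha>_has_derivative[OF assms] linear_has_derivative[OF lin[OF xU]]])
  then show ?thesis
    by (simp add: F_x[abs_def] Fy_def[abs_def])
qed

lemma F_square_has_derivative:
  assumes "y \<noteq> 0"
  shows "((\<lambda>u. (F x u)\<^sup>2) has_derivative (\<lambda>w. 2 * F x y * Fy y w)) (at y)"
  by (rule has_derivative_eq_rhs[OF has_derivative_power[OF F_has_derivative[OF assms], of 2]])
     (simp add: fun_eq_iff)

text \<open>The fundamental tensor at \<open>y\<close> as a bilinear form: $F_{y^i} F_{y^j} + F\, F_{y^i y^j}$ with the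
  Hessian of \<open>\<alpha>\<close> written out.\<close>

definition g :: "real^'n \<Rightarrow> real^'n \<Rightarrow> real^'n \<Rightarrow> real" where
  "g y w v = Fy y w * Fy y v + F x y * (B x v w - B x y v * B x y w / (\<alpha> y * \<alpha> y)) / \<alpha> y"

lemma fundamental_tensor_eq:
  assumes y: "y \<noteq> 0"
  shows "fundamental_tensor F x y $ i $ j = g y (axis i 1) (axis j 1)"
proof -
  let ?e = "axis j 1 :: real^'n"
  have ap: "\<alpha> y > 0" using \<alpha>_pos[OF y] .
  have "((\<lambda>u. 2 * F x u * (B x u ?e / \<alpha> u + \<beta> x ?e)) has_derivative
      (\<lambda>w. 2 * g y w ?e)) (at y)"
  proof -
    have l: "((\<lambda>u. B x u ?e) has_derivative (\<lambda>u. B x u ?e)) (at y)"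
      by (rule linear_has_derivative) (use bilin[OF xU] in \<open>simp add: bilinear_def\<close>)
    show ?thesis
      by (rule has_derivative_eq_rhs, rule has_derivative_mult[OF
            has_derivative_mult_right[OF F_has_derivative[OF y]]
            has_derivative_add[OF has_derivative_divide'[OF l \<alpha>_has_derivative[OF y] less_imp_neq[OF ap, symmetric]]
              has_derivative_const]])
         (use ap in \<open>simp add: fun_eq_iff g_def Fy_def sym[OF xU, of ?e] field_simps\<close>)
  qed
  moreover have "partial j (\<lambda>w. (F x w)\<^sup>2) u = 2 * F x u * (B x u ?e / \<alpha> u + \<beta> x ?e)"
    if "u \<in> - {0}" for u
    using partial_eq[OF F_square_has_derivative[of u]] that by (simp add: Fy_def)
  ultimately have "((\<lambda>u. partial j (\<lambda>w. (F x w)\<^sup>2) u) has_derivative (\<lambda>w. 2 * g y w ?e)) (at y)"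
    using y by (elim has_derivative_transform_within_open[where s="- {0}"]) auto
  from partial_eq[OF this] show ?thesis
    by (simp add: fundamental_tensor_def)
qed

text \<open>If \<open>v\<close> is in the kernel, testing with \<open>y\<close> gives \<open>Fy y v = 0\<close>. What remains is \<open>F / \<alpha>\<close> times the
  \<open>B x\<close>-projection along \<open>y\<close>, so that \<open>v\<close> is a multiple of \<open>y\<close>, and \<open>Fy y\<close> does not vanish
  on \<open>y\<close>.\<close>

lemma g_nondegenerate:
  assumes y: "y \<noteq> 0" and 0: "\<And>w. g y w v = 0"
  shows "v = 0"
proof -
  have ap: "\<alpha> y > 0" and Fp: "F x y > 0" using \<alpha>_pos[OF y] F_pos[OF y] by auto
  have "g y y v = F x y * Fy y v"
    using ap by (simp add: g_def Fy_self[OF y] \<alpha>_square[of y] sym[OF xU, of v y])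
  then have Fv: "Fy y v = 0" using 0[of y] Fp by simp
  let ?t = "B x y v / (\<alpha> y * \<alpha> y)"
  have "B x (v - ?t *\<^sub>R y) w = 0" for w
    using 0[of w] Fv Fp ap by (simp add: g_def)
  then have v: "v = ?t *\<^sub>R y" using pos[of "v - ?t *\<^sub>R y"] by fastforce
  then have "?t * F x y = 0" using Fv Fy_simps(2) Fy_self[OF y] by metis
  then have "?t = 0" using Fp by simp
  then show ?thesis using v by (metis scaleR_zero_left)
qed

lemma g_linear: "linear (g y w)"
  by (rule linearI) (simp_all add: g_def Fy_simps algebra_simps add_divide_distrib diff_divide_distrib)

lemma fundamental_tensor_mult:
  assumes "y \<noteq> 0"
  shows "(fundamental_tensor F x y *v v) $ i = g y (axis i 1) v"
  using linear_axis_expansion[OF g_linear, of y "axis i 1" v]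
  by (simp add: matrix_vector_mult_def fundamental_tensor_eq[OF assms] mult.commute)

lemma g_linear1: "linear (\<lambda>w. g y w v)"
  by (rule linearI) (simp_all add: g_def Fy_simps algebra_simps add_divide_distrib diff_divide_distrib)

lemma fundamental_tensor_invertible:
  assumes "y \<noteq> 0"
  shows "invertible (fundamental_tensor F x y)"
proof -
  have "v = 0" if "fundamental_tensor F x y *v v = 0" for v
  proof (rule g_nondegenerate[OF assms])
    fix w
    have "g y (axis i 1) v = 0" for i
      using fundamental_tensor_mult[OF assms, of v i] that by simp
    then show "g y w v = 0"
      by (subst linear_axis_expansion[OF g_linear1]) simp
  qed
  then show ?thesis
    by (simp add: invertible_left_inverse matrix_left_invertible_ker)
qed

subsection \<open>The spray\<close>

text \<open>The derivative of \<open>\<lambda>z. F z y\<close> at \<open>x\<close> in direction \<open>w\<close>.\<close>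

definition Fx :: "real^'n \<Rightarrow> real^'n \<Rightarrow> real" where
  "Fx y w = B' w y y / (2 * \<alpha> y) + \<beta>' w y"

lemma Fx_simps:
  "Fx y (u + v) = Fx y u + Fx y v" "Fx y (r *\<^sub>R u) = r * Fx y u"
  by (simp_all add: Fx_def add_divide_distrib distrib_left)

lemma F_square_has_derivative_base:
  assumes u: "u \<noteq> 0"
  shows "((\<lambda>z. (F z u)\<^sup>2) has_derivative (\<lambda>w. 2 * F x u * Fx u w)) (at x)"
proof -
  have "((\<lambda>z. sqrt (B z u u)) has_derivative (\<lambda>w. B' w u u * (inverse (\<alpha> u) / 2))) (at x)"
    using has_derivative_real_sqrt[OF pos[OF u] dB] unfolding \<alpha>_def .
  then have "((\<lambda>z. sqrt (B z u u) + \<beta> z u) has_derivative (Fx u)) (at x)"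
    by (rule has_derivative_eq_rhs[OF has_derivative_add[OF _ d\<beta>]])
       (simp add: fun_eq_iff Fx_def field_simps)
  then have "((\<lambda>z. F z u) has_derivative (Fx u)) (at x)"
    by (rule has_derivative_transform_within_open[OF _ openU xU]) (simp add: F_eq)
  from has_derivative_power[OF this, of 2] show ?thesis
    by (rule has_derivative_eq_rhs) (simp add: fun_eq_iff)
qed

text \<open>The mixed second derivative of \<open>F\<^sup>2\<close>, in direction \<open>w\<close> at the base point and \<open>v\<close> in the fibre.\<close>

definition FFxy :: "real^'n \<Rightarrow> real^'n \<Rightarrow> real^'n \<Rightarrow> real" where
  "FFxy y w v = 2 * (Fy y v * Fx y w +
     F x y * (B' w y v / \<alpha> y - B' w y y * B x y v / (2 * \<alpha> y ^ 3) + \<beta>' w v))"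

lemma FFxy_linear: "linear (\<lambda>w. FFxy y w v)"
  by (rule linearI)
     (simp_all add: FFxy_def Fx_simps add_divide_distrib diff_divide_distrib algebra_simps)

lemma F_square_mixed_derivative:
  assumes y: "y \<noteq> 0"
  shows "partial l (\<lambda>u. partial k (\<lambda>z. (F z u)\<^sup>2) x) y = FFxy y (axis k 1) (axis l 1)"
proof -
  let ?e = "axis k 1 :: real^'n"
  have ap: "\<alpha> y > 0" using \<alpha>_pos[OF y] .
  have B'_bilin: "bilinear (B' ?e)" and \<beta>'_lin: "linear (\<beta>' ?e)"
    by (auto simp: bilinear_def intro!: linearI)
  have dq: "((\<lambda>u. B' ?e u u) has_derivative (\<lambda>v. 2 * B' ?e y v)) (at y)"
    by (rule bilinear_diag_has_derivative[OF B'_bilin B'_sym])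
  have da: "((\<lambda>u. 2 * \<alpha> u) has_derivative (\<lambda>v. 2 * (B x y v / \<alpha> y))) (at y)"
    by (rule has_derivative_mult_right[OF \<alpha>_has_derivative[OF y]])
  have ne: "2 * \<alpha> y \<noteq> 0" using ap by simp
  have "((\<lambda>u. 2 * F x u * (B' ?e u u / (2 * \<alpha> u) + \<beta>' ?e u)) has_derivative FFxy y ?e) (at y)"
    by (rule has_derivative_eq_rhs, rule has_derivative_mult[OF
          has_derivative_mult_right[OF F_has_derivative[OF y]]
          has_derivative_add[OF has_derivative_divide'[OF dq da ne]
            linear_has_derivative[OF \<beta>'_lin]]])
       (use ap in \<open>simp add: fun_eq_iff FFxy_def Fx_def field_simps power3_eq_cube\<close>)
  moreover have "partial k (\<lambda>z. (F z u)\<^sup>2) x = 2 * F x u * (B' ?e u u / (2 * \<alpha> u) + \<beta>' ?e u)"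
    if "u \<in> - {0}" for u
    using partial_eq[OF F_square_has_derivative_base[of u]] that by (simp add: Fx_def)
  ultimately have "((\<lambda>u. partial k (\<lambda>z. (F z u)\<^sup>2) x) has_derivative FFxy y ?e) (at y)"
    using y by (elim has_derivative_transform_within_open[where s="- {0}"]) auto
  from partial_eq[OF this] show ?thesis .
qed

text \<open>Two equations pin down the spray vector. The Euler--Lagrange equations of the energy
  \<open>F\<^sup>2 / 2\<close> say that it is determined by its product with the fundamental tensor; in that
  product the component along \<open>y\<close> only enters through \<open>Fy\<close>, and what is left is an equation for
  the Riemannian metric \<open>B x\<close> alone, up to multiples of \<open>y\<close>.\<close>

lemma spray_eqI:
  assumes y: "y \<noteq> 0"
    and V: "\<And>w. B x V w = B' y y w - B' w y y / 2 + \<alpha> y * (\<beta>' y w - \<beta>' w y) + \<kappa> * B x y w"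
    and FV: "Fy y V = Fx y y"
  shows "spray F i x y = V $ i / 2"
proof -
  let ?M = "fundamental_tensor F x y"
  have ap: "\<alpha> y > 0" using \<alpha>_pos[OF y] .
  have g: "(\<Sum>k\<in>UNIV. FFxy y (axis k 1) (axis l 1) * y $ k) - 2 * F x y * Fx y (axis l 1)
      = 2 * (?M *v V) $ l" for l
  proof -
    let ?e = "axis l 1 :: real^'n"
    have yV: "B x y V = B' y y y / 2 + \<kappa> * (\<alpha> y * \<alpha> y)"
      using V[of y] by (simp add: sym[OF xU, of y V] \<alpha>_square)
    have "FFxy y y ?e - 2 * F x y * Fx y ?e = 2 * g y ?e V"
      using ap by (simp add: g_def FFxy_def FV V yV Fx_def field_simps power3_eq_cube)
    then show ?thesis
      using linear_axis_expansion[OF FFxy_linear[of y ?e], of y]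
      by (simp add: fundamental_tensor_mult[OF y] mult.commute)
  qed
  have "spray F i x y = 1/4 * (\<Sum>l\<in>UNIV. matrix_inv ?M $ i $ l * (2 * (?M *v V) $ l))"
    unfolding spray_def
    by (simp only: F_square_mixed_derivative[OF y] partial_eq[OF F_square_has_derivative_base[OF y]] g)
  also have "\<dots> = (matrix_inv ?M *v (?M *v V)) $ i / 2"
    by (simp add: matrix_vector_mult_def[of "matrix_inv ?M"] sum_distrib_left sum_divide_distrib mult_ac)
  also have "matrix_inv ?M *v (?M *v V) = V"
    using fundamental_tensor_invertible[OF y]
    by (simp add: matrix_vector_mul_assoc matrix_inv_mult_left)
  finally show ?thesis .
qed

definition sharp :: "(real^'n \<Rightarrow> real) \<Rightarrow> real^'n" where
  "sharp \<phi> = (SOME V. \<forall>w. B x V w = \<phi> w)"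

lemma B_cancel:
  assumes "\<And>w. B x u w = B x v w"
  shows "u = v"
  using pos[of "u - v"] assms[of "u - v"] by fastforce

lemma B_sharp:
  assumes "linear \<phi>"
  shows "B x (sharp \<phi>) w = \<phi> w"
proof -
  define f :: "real^'n \<Rightarrow> real^'n" where "f V = (\<chi> i. B x V (axis i 1))" for V
  have l: "linear (B x V)" for V using bilin[OF xU] by (simp add: bilinear_def)
  have "linear f"
    by (rule linearI) (simp_all add: f_def vec_eq_iff)
  moreover have "inj f"
  proof (rule injI)
    fix u v assume "f u = f v"
    then have "B x u (axis i 1) = B x v (axis i 1)" for i by (simp add: f_def vec_eq_iff)
    then have "B x u w = B x v w" for w
      by (subst (1 2) linear_axis_expansion[OF l]) simp
    then show "u = v" by (rule B_cancel)
  qed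
  ultimately have "surj f"
    by (rule linear_injective_imp_surjective) simp
  then obtain V where "f V = (\<chi> i. \<phi> (axis i 1))" by (metis surjD)
  then have "B x V (axis i 1) = \<phi> (axis i 1)" for i by (simp add: f_def vec_eq_iff)
  then have "B x V w = \<phi> w" for w
    by (subst linear_axis_expansion[OF l], subst linear_axis_expansion[OF assms]) simp
  then have "\<forall>w. B x (sharp \<phi>) w = \<phi> w"
    unfolding sharp_def by (intro someI[where P="\<lambda>V. \<forall>w. B x V w = \<phi> w" and x=V] allI)
  then show ?thesis ..
qed

text \<open>The components of the covector \<open>\<tau> y y\<close> are $a_{il} \gamma^i_{jk} y^j y^k$ with the Christoffel
  symbols $\gamma$ of the Riemannian metric $a$, so that \<open>T y y\<close> is twice its geodesic spray.
  Off the diagonal \<open>T\<close> is not symmetric, but the spray only involves the diagonal.\<close>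

definition \<tau> :: "real^'n \<Rightarrow> real^'n \<Rightarrow> real^'n \<Rightarrow> real" where
  "\<tau> u v w = B' u v w - B' w u v / 2"

definition T :: "real^'n \<Rightarrow> real^'n \<Rightarrow> real^'n" where
  "T u v = sharp (\<tau> u v)"

text \<open>The exterior derivative of the one-form, contracted with \<open>y\<close>, with its index raised.\<close>

definition S :: "real^'n \<Rightarrow> real^'n" where
  "S y = sharp (\<lambda>w. \<beta>' y w - \<beta>' w y)"

lemma B_T: "B x (T u v) w = \<tau> u v w"
  unfolding T_def
  by (rule B_sharp, rule linearI) (simp_all add: \<tau>_def add_divide_distrib right_diff_distrib)

lemma B_S: "B x (S y) w = \<beta>' y w - \<beta>' w y"
  unfolding S_def by (rule B_sharp, rule linearI) (simp_all add: right_diff_distrib)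

lemma T_bilinear: "bilinear T"
  unfolding bilinear_def
  by (intro conjI allI; rule linearI; rule B_cancel)
     (simp_all add: B_T \<tau>_def add_divide_distrib right_diff_distrib)

lemma T_minus: "T (- y) (- y) = T y y"
  by (simp add: bilinear_lneg[OF T_bilinear] bilinear_rneg[OF T_bilinear])

lemma S_minus: "S (- y) = - S y"
  by (rule B_cancel) (simp add: B_S)

text \<open>The multiple of \<open>y\<close> that has to be added for the second equation of \<open>spray_eqI\<close> to hold,
  given that \<open>Fy y y = F x y\<close>.\<close>

definition \<mu> :: "real^'n \<Rightarrow> real" where
  "\<mu> y = (Fx y y - Fy y (T y y + \<alpha> y *\<^sub>R S y)) / F x y"

lemma spray_eq:
  assumes y: "y \<noteq> 0"
  shows "spray F i x y = (T y y + \<alpha> y *\<^sub>R S y + \<mu> y *\<^sub>R y) $ i / 2"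
proof (rule spray_eqI[OF y, where \<kappa>="\<mu> y"])
  show "B x (T y y + \<alpha> y *\<^sub>R S y + \<mu> y *\<^sub>R y) w
      = B' y y w - B' w y y / 2 + \<alpha> y * (\<beta>' y w - \<beta>' w y) + \<mu> y * B x y w" for w
    by (simp add: B_T B_S \<tau>_def)
  show "Fy y (T y y + \<alpha> y *\<^sub>R S y + \<mu> y *\<^sub>R y) = Fx y y"
    unfolding Fy_simps(1)[of y "T y y + \<alpha> y *\<^sub>R S y"] Fy_simps(2)[of y "\<mu> y"] Fy_self[OF y]
    using F_pos[OF y] by (simp add: \<mu>_def)
qed

lemma closed_iff_S: "(\<forall>u v. \<beta>' u v = \<beta>' v u) \<longleftrightarrow> (\<forall>y. S y = 0)"
proof
  assume "\<forall>u v. \<beta>' u v = \<beta>' v u"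
  then have "B x (S y) w = B x 0 w" for y w by (simp add: B_S)
  then show "\<forall>y. S y = 0" using B_cancel by blast
next
  assume "\<forall>y. S y = 0"
  then have "\<beta>' u v - \<beta>' v u = 0" for u v by (metis B_S B_simps(9))
  then show "\<forall>u v. \<beta>' u v = \<beta>' v u" by simp
qed

lemma T_axis_expansion:
  "T y y $ i = (\<Sum>j\<in>UNIV. \<Sum>k\<in>UNIV. T (axis j 1) (axis k 1) $ i * y $ j * y $ k)"
  by (subst bilinear_axis_expansion[OF T_bilinear]) (simp add: mult_ac)

text \<open>This makes \<open>\<mu>\<close> an admissible factor in the definition of Douglas type.\<close>

lemma \<mu>_homogeneous:
  assumes "y \<noteq> 0" "t > 0"
  shows "\<mu> (t *\<^sub>R y) = t * \<mu> y"
proof -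
  have S: "S (t *\<^sub>R y) = t *\<^sub>R S y"
    by (rule B_cancel) (simp add: B_S right_diff_distrib)
  have T: "T (t *\<^sub>R y) (t *\<^sub>R y) = t *\<^sub>R t *\<^sub>R T y y"
    by (simp add: bilinear_lmul[OF T_bilinear] bilinear_rmul[OF T_bilinear])
  have "Fy (t *\<^sub>R y) w = Fy y w" for w
    using assms by (simp add: Fy_def \<alpha>_scale)
  moreover have "Fx (t *\<^sub>R y) (t *\<^sub>R y) = t * t * Fx y y"
    using assms \<alpha>_pos[of y] by (simp add: Fx_def \<alpha>_scale field_simps)
  moreover have "F x (t *\<^sub>R y) = t * F x y"
    using assms by (simp add: F_x \<alpha>_scale distrib_left)
  ultimately show ?thesis
    using assms F_pos[of y] by (simp add: \<mu>_def S T \<alpha>_scale Fy_simps field_simps)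
qed

text \<open>Reversing \<open>y\<close> separates the spray into its even and odd parts. In a spray of Douglas type
  the odd part is a multiple of \<open>y\<close>, whereas the formula above gives \<open>\<alpha> y *\<^sub>R S y\<close> up to such a
  multiple. As \<open>S y\<close> is orthogonal to \<open>y\<close>, it vanishes.\<close>

theorem douglas_at_iff_closed: "douglas_at F x \<longleftrightarrow> (\<forall>u v. \<beta>' u v = \<beta>' v u)"
proof
  assume "douglas_at F x"
  then obtain \<Gamma> P where \<Gamma>: "\<And>y i. y \<noteq> 0 \<Longrightarrow>
      spray F i x y = 1/2 * (\<Sum>j\<in>UNIV. \<Sum>k\<in>UNIV. \<Gamma> i j k * y $ j * y $ k) + P y * y $ i"
    unfolding douglas_at_def by blast
  have "S y = 0" if y: "y \<noteq> 0" for y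
  proof -
    let ?c = "2 * P y + 2 * P (- y) - \<mu> y - \<mu> (- y)"
    have "2 * (\<alpha> y * S y $ i) = ?c * y $ i" for i
    proof -
      let ?Q = "\<Sum>j\<in>UNIV. \<Sum>k\<in>UNIV. \<Gamma> i j k * y $ j * y $ k"
      have "(T y y $ i + \<alpha> y * S y $ i + \<mu> y * y $ i) / 2 = 1/2 * ?Q + P y * y $ i"
        using \<Gamma>[OF y, of i] y by (simp add: spray_eq)
      moreover have "(T y y $ i - \<alpha> y * S y $ i - \<mu> (- y) * y $ i) / 2 = 1/2 * ?Q - P (- y) * y $ i"
        using \<Gamma>[of "- y" i] y by (simp add: spray_eq T_minus S_minus \<alpha>_minus)
      moreover have "2 * a = 2 * p + 2 * p' - m - m'"
        if "(t + a + m) / 2 = q + p" "(t - a - m') / 2 = q - p'" for t a m m' p p' q :: real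
        using that by (simp add: field_simps)
      ultimately have "2 * (\<alpha> y * S y $ i) = 2 * (P y * y $ i) + 2 * (P (- y) * y $ i)
          - \<mu> y * y $ i - \<mu> (- y) * y $ i"
        by blast
      then show ?thesis by (simp add: distrib_right left_diff_distrib)
    qed
    then have "(2 * \<alpha> y) *\<^sub>R S y = ?c *\<^sub>R y"
      by (simp add: vec_eq_iff mult.assoc)
    then have "B x ((2 * \<alpha> y) *\<^sub>R S y) (S y) = B x (?c *\<^sub>R y) (S y)" by (rule arg_cong)
    also have "\<dots> = 0"
      using sym[OF xU, of y "S y"] by (simp add: B_S)
    finally have "B x (S y) (S y) = 0"
      using \<alpha>_pos[OF y] by simp
    then show ?thesis using pos[of "S y"] by fastforce
  qed
  moreover have "S 0 = 0" using S_minus[of 0] by (simp add: vec_eq_iff)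
  ultimately show "\<forall>u v. \<beta>' u v = \<beta>' v u"
    unfolding closed_iff_S by metis
next
  assume "\<forall>u v. \<beta>' u v = \<beta>' v u"
  then have "S y = 0" for y using closed_iff_S by blast
  then have "spray F i x y = 1/2 * (\<Sum>j\<in>UNIV. \<Sum>k\<in>UNIV. T (axis j 1) (axis k 1) $ i * y $ j * y $ k)
      + \<mu> y / 2 * y $ i" if "y \<noteq> 0" for y i
    using that by (simp add: spray_eq T_axis_expansion[symmetric] add_divide_distrib)
  then show "douglas_at F x"
    unfolding douglas_at_def using \<mu>_homogeneous
    by (intro exI[of _ "\<lambda>i j k. T (axis j 1) (axis k 1) $ i"] exI[of _ "\<lambda>y. \<mu> y / 2"]) simp
qed

text \<open>For a closed form, the coefficient \<open>\<mu>\<close> of \<open>y\<close> in the spray is the covariant derivative of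
  the form on the diagonal, divided by \<open>F\<close>.\<close>

lemma \<mu>_closed:
  assumes "\<forall>u v. \<beta>' u v = \<beta>' v u" and y: "y \<noteq> 0"
  shows "\<mu> y * (\<alpha> y + \<beta> x y) = \<beta>' y y - \<tau> y y \<xi>"
proof -
  have S: "S y = 0" using assms(1) closed_iff_S by blast
  have "Fy y (T y y) = \<tau> y y y / \<alpha> y + \<tau> y y \<xi>"
    using B_T[of y y] by (simp add: Fy_def \<beta>_xi sym[OF xU, of y "T y y"] sym[OF xU, of \<xi> "T y y"])
  moreover have "F x y > 0" by (rule F_pos[OF y])
  ultimately show ?thesis
    using \<alpha>_pos[OF y] by (simp add: \<mu>_def S Fx_def F_x \<tau>_def)
qed

text \<open>For a closed form the odd part of a spray of Berwald type, which is \<open>(\<mu> y + \<mu> (- y)) *\<^sub>R y\<close>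
  up to a factor, vanishes. On the other hand \<open>\<mu> y\<close> is an even function divided by
  \<open>\<alpha> y + \<beta> x y\<close>, so that \<open>\<mu> (- y) = - \<mu> y\<close> forces \<open>\<mu> y * \<alpha> y = 0\<close>. The condition that results says
  that the form is parallel.\<close>

theorem berwald_at_iff_parallel:
  "berwald_at F x \<longleftrightarrow>
     (\<forall>u v. \<beta>' u v = \<beta>' v u) \<and> (\<forall>y. B' y y \<xi> - B' \<xi> y y / 2 = \<beta>' y y)"
proof
  assume b: "berwald_at F x"
  then obtain \<Gamma> where \<Gamma>: "\<And>y i. y \<noteq> 0 \<Longrightarrow>
      spray F i x y = 1/2 * (\<Sum>j\<in>UNIV. \<Sum>k\<in>UNIV. \<Gamma> i j k * y $ j * y $ k)"
    unfolding berwald_at_def by blast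
  have closed: "\<forall>u v. \<beta>' u v = \<beta>' v u"
    using berwald_at_imp_douglas_at[OF b] douglas_at_iff_closed by blast
  then have S: "S y = 0" for y using closed_iff_S by blast
  have "B' y y \<xi> - B' \<xi> y y / 2 = \<beta>' y y" for y
  proof (cases "y = 0")
    case True
    then show ?thesis
      using B'_simps(6)[where r=0] B'_simps(4)[where r=0] \<beta>'_simps(3)[where r=0] by simp
  next
    case y: False
    have "(\<mu> y + \<mu> (- y)) * y $ i = 0" for i
      using \<Gamma>[OF y, of i] \<Gamma>[of "- y" i] y
      by (simp add: spray_eq T_minus S \<alpha>_minus algebra_simps)
    moreover obtain i where "y $ i \<noteq> 0"
      using y by (auto simp: vec_eq_iff)
    ultimately have odd: "\<mu> (- y) = - \<mu> y"
      by (metis mult_eq_0_iff add_eq_0_iff)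
    have e: "\<mu> y * (\<alpha> y + \<beta> x y) = \<beta>' y y - \<tau> y y \<xi>"
      by (rule \<mu>_closed[OF closed y])
    moreover have "\<mu> (- y) * (\<alpha> y - \<beta> x y) = \<beta>' y y - \<tau> y y \<xi>"
      using \<mu>_closed[OF closed, of "- y"] y by (simp add: \<alpha>_minus \<tau>_def)
    ultimately have "\<mu> y * \<alpha> y = 0"
      unfolding odd by (simp only: distrib_left right_diff_distrib mult_minus_left)
    then have "\<mu> y = 0" using \<alpha>_pos[OF y] by simp
    with e show ?thesis by (simp add: \<tau>_def)
  qed
  with closed show "(\<forall>u v. \<beta>' u v = \<beta>' v u) \<and> (\<forall>y. B' y y \<xi> - B' \<xi> y y / 2 = \<beta>' y y)"
    by blast
next
  assume *: "(\<forall>u v. \<beta>' u v = \<beta>' v u) \<and> (\<forall>y. B' y y \<xi> - B' \<xi> y y / 2 = \<beta>' y y)"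
  then have closed: "\<forall>u v. \<beta>' u v = \<beta>' v u" and S: "S y = 0" for y
    using closed_iff_S by blast+
  have "\<mu> y = 0" if y: "y \<noteq> 0" for y
  proof -
    have "\<mu> y * (\<alpha> y + \<beta> x y) = 0"
      using \<mu>_closed[OF closed y] * by (simp add: \<tau>_def)
    then show ?thesis using F_pos[OF y] by (simp add: F_x)
  qed
  then have "spray F i x y = 1/2 * (\<Sum>j\<in>UNIV. \<Sum>k\<in>UNIV. T (axis j 1) (axis k 1) $ i * y $ j * y $ k)"
    if "y \<noteq> 0" for y i
    using that by (simp add: spray_eq S T_axis_expansion[symmetric])
  then show "berwald_at F x"
    unfolding berwald_at_def by (intro exI[of _ "\<lambda>i j k. T (axis j 1) (axis k 1) $ i"]) simp
qed

subsection \<open>The osculating metric\<close>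

text \<open>The one-form is multiplied by the constant \<open>(1 + N)\<^sup>2\<close>, which settles closedness. For a closed
  form, the left-hand side \<open>L\<close> of the equation in \<open>berwald_at_iff_parallel\<close> becomes
  \<open>(1 + N) * (L + N * \<beta>' y y)\<close>, the second term coming from the rank-one correction of \<open>B\<close>. So the
  difference of the two sides is just multiplied by \<open>1 + N\<close>.\<close>

theorem osculating_same_type:
  assumes N: "N > 0" "B x \<xi> \<xi> = N\<^sup>2" and small: "(1 + N) * N < 1"
    and F2: "\<And>z u. z \<in> U \<Longrightarrow> F2 z u =
      sqrt ((1 + N) * (B z u u + 1 / N * \<beta> z u * \<beta> z u)) + (1 + N)\<^sup>2 * \<beta> z u"
  shows "douglas_at F2 x \<longleftrightarrow> douglas_at F x" and "berwald_at F2 x \<longleftrightarrow> berwald_at F x"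
proof -
  let ?B = "\<lambda>z u v. (1 + N) * (B z u v + 1 / N * \<beta> z u * \<beta> z v)"
  let ?B' = "\<lambda>w u v. (1 + N) * (B' w u v + 1 / N * (\<beta>' w u * \<beta> x v + \<beta> x u * \<beta>' w v))"
  have \<beta>\<xi>: "\<beta> x \<xi> = N\<^sup>2" using N(2) by (simp add: \<beta>_xi)
  interpret osc: randers_germ U x ?B ?B' "\<lambda>z u. (1 + N)\<^sup>2 * \<beta> z u" "\<lambda>w u. (1 + N)\<^sup>2 * \<beta>' w u" \<xi> F2
  proof (rule randers_germ.intro)
    show "open U" "x \<in> U" by (rule openU, rule xU)
    show "bilinear (?B z)" if "z \<in> U" for z
      using bilin[OF that, THEN bilinear_ladd] bilin[OF that, THEN bilinear_radd]
        bilin[OF that, THEN bilinear_lmul] bilin[OF that, THEN bilinear_rmul]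
        linear_add[OF lin[OF that]] linear_scale[OF lin[OF that]]
      unfolding bilinear_def by (intro conjI allI linearI) (simp_all add: algebra_simps)
    show "?B z u v = ?B z v u" if "z \<in> U" for z u v
      using sym[OF that, of u v] by simp
    show "?B x u u > 0" if "u \<noteq> 0" for u
      using pos[OF that] N(1) by (auto intro!: mult_pos_pos add_pos_nonneg)
    show "linear (\<lambda>u. (1 + N)\<^sup>2 * \<beta> z u)" if "z \<in> U" for z
      using linear_compose_scale_right[OF lin[OF that], of "(1 + N)\<^sup>2"] by simp
    show "((\<lambda>z. ?B z u v) has_derivative (\<lambda>w. ?B' w u v)) (at x)" for u v
      by (rule has_derivative_eq_rhs, rule has_derivative_mult_right, rule has_derivative_add[OF dB
            has_derivative_mult[OF has_derivative_mult_right[OF d\<beta>] d\<beta>]])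
         (simp add: fun_eq_iff algebra_simps)
    show "((\<lambda>z. (1 + N)\<^sup>2 * \<beta> z u) has_derivative (\<lambda>w. (1 + N)\<^sup>2 * \<beta>' w u)) (at x)" for u
      by (rule has_derivative_mult_right[OF d\<beta>])
    show "(1 + N)\<^sup>2 * \<beta> x u = ?B x \<xi> u" for u
      using N(1) by (simp add: \<beta>\<xi> \<beta>_xi[symmetric] power2_eq_square field_simps)
    have "?B x \<xi> \<xi> = ((1 + N) * N)\<^sup>2"
      using N(1) by (simp add: \<beta>\<xi> N(2) power2_eq_square field_simps)
    then show "?B x \<xi> \<xi> < 1"
      using N(1) small by (simp add: abs_square_less_1)
    show "F2 z u = sqrt (?B z u u) + (1 + N)\<^sup>2 * \<beta> z u" if "z \<in> U" for z u
      by (rule F2[OF that])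
  qed
  have closed: "(\<forall>u v. (1 + N)\<^sup>2 * \<beta>' u v = (1 + N)\<^sup>2 * \<beta>' v u) \<longleftrightarrow> (\<forall>u v. \<beta>' u v = \<beta>' v u)"
    using N(1) by simp
  show "douglas_at F2 x \<longleftrightarrow> douglas_at F x"
    unfolding osc.douglas_at_iff_closed douglas_at_iff_closed by (rule closed)
  have "?B' y y \<xi> - ?B' \<xi> y y / 2 = (1 + N)\<^sup>2 * \<beta>' y y \<longleftrightarrow> B' y y \<xi> - B' \<xi> y y / 2 = \<beta>' y y"
    if "\<forall>u v. \<beta>' u v = \<beta>' v u" for y
  proof -
    have "\<beta>' y \<xi> = \<beta>' \<xi> y" using that by blast
    then have "?B' y y \<xi> - ?B' \<xi> y y / 2 - (1 + N)\<^sup>2 * \<beta>' y y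
        = (1 + N) * (B' y y \<xi> - B' \<xi> y y / 2 - \<beta>' y y)"
      using N(1) by (simp add: \<beta>\<xi> power2_eq_square field_simps)
    then show ?thesis
      using N(1) by (metis eq_iff_diff_eq_0 less_add_same_cancel1 mult_eq_0_iff not_one_less_zero
          add_pos_pos zero_less_one less_irrefl)
  qed
  then show "berwald_at F2 x \<longleftrightarrow> berwald_at F x"
    unfolding osc.berwald_at_iff_parallel berwald_at_iff_parallel closed by blast
qed

end

section \<open>Tangent vectors in charts\<close>

lemma smooth_on_differentiable:
  "smooth_on S f \<Longrightarrow> x \<in> S \<Longrightarrow> f differentiable (at x)"
  unfolding smooth_on_def by (metis Ck_on.simps(2))

locale smooth_manifold =
  fixes A :: "('g::topological_space, 'n::finite) chart set"
  assumes smooth: "smooth_structure A"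
begin

lemma chart: "c \<in> A \<Longrightarrow> is_chart c"
  using smooth unfolding smooth_structure_def by blast

lemma param_coord: "c \<in> A \<Longrightarrow> p \<in> dom_of c \<Longrightarrow> param c (coord c p) = p"
  using chart unfolding is_chart_def homeomorphism_def by blast

lemma open_overlap:
  assumes "c \<in> A" "d \<in> A"
  shows "open (coord c ` (dom_of c \<inter> dom_of d))"
proof -
  have c: "open (dom_of c)" "open (image_of c)" "open (dom_of d)"
    "homeomorphism (dom_of c) (image_of c) (coord c) (param c)"
    using chart assms unfolding is_chart_def by blast+
  have "openin (top_of_set (image_of c)) (coord c ` (dom_of c \<inter> dom_of d))"
    by (rule homeomorphism_imp_open_map[OF c(4)]) (use c(3) in \<open>auto simp: openin_open\<close>)
  then show ?thesis
    using c(2) openin_open_trans by blast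
qed

definition transition :: "('g, 'n) chart \<Rightarrow> ('g, 'n) chart \<Rightarrow> 'g \<Rightarrow> real^'n \<Rightarrow> real^'n" where
  "transition c d p = frechet_derivative (coord d \<circ> param c) (at (coord c p))"

lemma transition_has_derivative:
  assumes "c \<in> A" "d \<in> A" "p \<in> dom_of c" "p \<in> dom_of d"
  shows "((coord d \<circ> param c) has_derivative transition c d p) (at (coord c p))"
proof -
  have "smooth_on (coord c ` (dom_of c \<inter> dom_of d)) (coord d \<circ> param c)"
    using smooth assms unfolding smooth_structure_def compatible_def by blast
  then have "(coord d \<circ> param c) differentiable (at (coord c p))"
    using assms by (blast intro: smooth_on_differentiable)
  then show ?thesis
    unfolding transition_def by (simp add: frechet_derivative_works)
qed

text \<open>The chain rule; the composed coordinate changes agree with the direct one only near the point,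
  on the overlap of the charts.\<close>

lemma transition_transition:
  assumes "c \<in> A" "d \<in> A" "e \<in> A" "p \<in> dom_of c" "p \<in> dom_of d" "p \<in> dom_of e"
  shows "transition d e p (transition c d p y) = transition c e p y"
proof -
  have "((coord e \<circ> param d) has_derivative transition d e p) (at ((coord d \<circ> param c) (coord c p)))"
    using transition_has_derivative[of d e p] assms by (simp add: param_coord)
  from diff_chain_at[OF transition_has_derivative[of c d p] this] assms
  have "((coord e \<circ> param d) \<circ> (coord d \<circ> param c) has_derivative
      transition d e p \<circ> transition c d p) (at (coord c p))" by blast
  then have "((coord e \<circ> param c) has_derivative transition d e p \<circ> transition c d p) (at (coord c p))"
    by (rule has_derivative_transform_within_open[OF _ open_overlap[of c d]])
       (use assms in \<open>auto simp: param_coord\<close>)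
  then have "transition d e p \<circ> transition c d p = transition c e p"
    using has_derivative_unique transition_has_derivative[of c e p] assms by blast
  then show ?thesis by (metis comp_apply)
qed

lemma transition_self:
  assumes "c \<in> A" "p \<in> dom_of c"
  shows "transition c c p y = y"
proof -
  have "((\<lambda>z. z) has_derivative (\<lambda>y. y)) (at (coord c p))" by (rule has_derivative_ident)
  then have "((coord c \<circ> param c) has_derivative (\<lambda>y. y)) (at (coord c p))"
    by (rule has_derivative_transform_within_open[OF _ open_overlap[of c c]])
       (use assms in \<open>auto simp: param_coord\<close>)
  then have "transition c c p = (\<lambda>y. y)"
    using has_derivative_unique transition_has_derivative[of c c p] assms by blast
  then show ?thesis by simp
qed

lemma coord_vec_eq:
  "coord_vec A c p y d = (if d \<in> A \<and> p \<in> dom_of d then transition c d p y else 0)"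
  by (simp add: coord_vec_def transition_def)

lemma coord_vec_tangent:
  assumes "c \<in> A" "p \<in> dom_of c"
  shows "coord_vec A c p y \<in> tangent_space A p"
  unfolding tangent_space_def
  using assms transition_transition[of c] by (auto simp: coord_vec_eq simp flip: transition_def)

lemma coord_vec_component:
  assumes "c \<in> A" "p \<in> dom_of c"
  shows "coord_vec A c p y c = y"
  using assms by (simp add: coord_vec_eq transition_self)

lemma tangent_eq_coord_vec:
  assumes "c \<in> A" "p \<in> dom_of c" "v \<in> tangent_space A p"
  shows "coord_vec A c p (v c) = v"
proof
  fix d
  have "v d = transition c d p (v c)" if "d \<in> A" "p \<in> dom_of d"
    using assms that unfolding tangent_space_def transition_def by blast
  moreover have "v d = 0" if "\<not> (d \<in> A \<and> p \<in> dom_of d)"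
    using assms(3) that unfolding tangent_space_def by blast
  ultimately show "coord_vec A c p (v c) d = v d"
    by (simp add: coord_vec_eq)
qed

lemma coord_vec_combination:
  assumes "c \<in> A" "p \<in> dom_of c"
  shows "coord_vec A c p (a *\<^sub>R u + b *\<^sub>R v) =
    (\<lambda>d. a *\<^sub>R coord_vec A c p u d + b *\<^sub>R coord_vec A c p v d)"
proof -
  have l: "linear (transition c d p)" if "d \<in> A" "p \<in> dom_of d" for d
    using transition_has_derivative[of c d p] assms that has_derivative_linear by blast
  show ?thesis
    by (auto simp: fun_eq_iff coord_vec_eq linear_add[OF l] linear_scale[OF l])
qed

lemma coord_vec_nonzero:
  assumes "c \<in> A" "p \<in> dom_of c" "y \<noteq> 0"
  shows "coord_vec A c p y \<noteq> (\<lambda>d. 0)"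
  using coord_vec_component[OF assms(1,2), of y] assms(3) by auto

end

locale riemannian_manifold = smooth_manifold A
  for A :: "('g::topological_space, 'n::finite) chart set" +
  fixes h :: "'g \<Rightarrow> ('g, 'n) tvec \<Rightarrow> ('g, 'n) tvec \<Rightarrow> real"
  assumes metric: "riemannian_metric A h"
begin

text \<open>The matrix $a_{ij}$ of the metric in a chart, as a bilinear form.\<close>

definition gram :: "('g, 'n) chart \<Rightarrow> real^'n \<Rightarrow> real^'n \<Rightarrow> real^'n \<Rightarrow> real" where
  "gram c z u v = h (param c z) (coord_vec A c (param c z) u) (coord_vec A c (param c z) v)"

lemma metric_sym:
  "u \<in> tangent_space A p \<Longrightarrow> v \<in> tangent_space A p \<Longrightarrow> h p u v = h p v u"
  using metric unfolding riemannian_metric_def by (elim conjE) blast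

lemma metric_combination:
  assumes "u \<in> tangent_space A p" "v \<in> tangent_space A p" "w \<in> tangent_space A p"
  shows "h p (\<lambda>c. a *\<^sub>R u c + b *\<^sub>R v c) w = a * h p u w + b * h p v w"
  using metric assms unfolding riemannian_metric_def by (elim conjE) simp

lemma metric_pos: "v \<in> tangent_space A p \<Longrightarrow> v \<noteq> (\<lambda>c. 0) \<Longrightarrow> h p v v > 0"
  using metric unfolding riemannian_metric_def by (elim conjE) simp

lemma metric_smooth:
  "c \<in> A \<Longrightarrow> smooth_on (image_of c) (\<lambda>z. gram c z (axis i 1) (axis j 1))"
  using metric unfolding riemannian_metric_def gram_def by (elim conjE) simp

lemma gram_sym:
  assumes "c \<in> A" "z \<in> image_of c"
  shows "gram c z u v = gram c z v u"
  unfolding gram_def by (intro metric_sym coord_vec_tangent assms inv_into_into)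

lemma gram_pos:
  assumes "c \<in> A" "z \<in> image_of c" "u \<noteq> 0"
  shows "gram c z u u > 0"
  unfolding gram_def by (intro metric_pos coord_vec_tangent coord_vec_nonzero assms inv_into_into)

lemma gram_bilinear:
  assumes "c \<in> A" "z \<in> image_of c"
  shows "bilinear (gram c z)"
proof -
  have comb: "gram c z (a *\<^sub>R u + b *\<^sub>R v) w = a * gram c z u w + b * gram c z v w" for a b u v w
    unfolding gram_def coord_vec_combination[OF assms(1) inv_into_into[OF assms(2)]]
    by (intro metric_combination coord_vec_tangent assms inv_into_into)
  have l: "linear (\<lambda>u. gram c z u w)" for w
    using comb[of 1 _ 1 _ w] comb[of _ _ 0 0 w] by (intro linearI) simp_all
  then have "linear (\<lambda>u. gram c z w u)" for w
    by (subst gram_sym[OF assms])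
  with l show ?thesis by (simp add: bilinear_def)
qed

text \<open>Smoothness is given for the coordinate vectors; bilinearity carries it over to all vectors,
  but only on the image of the chart, as \<open>gram c\<close> is arbitrary outside.\<close>

lemma gram_differentiable:
  assumes c: "c \<in> A" and x: "x \<in> image_of c"
  shows "(\<lambda>z. gram c z u v) differentiable (at x)"
proof -
  have "(\<lambda>z. gram c z (axis i 1) (axis j 1)) differentiable (at x)" for i j
    by (rule smooth_on_differentiable[OF metric_smooth[OF c] x])
  then have "(\<lambda>z. \<Sum>i\<in>UNIV. \<Sum>j\<in>UNIV. (u $ i * v $ j) *\<^sub>R gram c z (axis i 1) (axis j 1))
      differentiable (at x)"
    by (intro differentiable_sum differentiable_scaleR) auto
  then obtain D where "((\<lambda>z. \<Sum>i\<in>UNIV. \<Sum>j\<in>UNIV. (u $ i * v $ j) *\<^sub>R gram c z (axis i 1) (axis j 1))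
      has_derivative D) (at x)"
    unfolding differentiable_def by blast
  moreover have "open (image_of c)"
    using chart[OF c] by (simp add: is_chart_def)
  ultimately have "((\<lambda>z. gram c z u v) has_derivative D) (at x)"
    by (rule has_derivative_transform_within_open[OF _ _ x])
       (rule bilinear_axis_expansion[OF gram_bilinear[OF c], symmetric])
  then show ?thesis unfolding differentiable_def by blast
qed

lemma norm_wrt_pos:
  "v \<in> tangent_space A p \<Longrightarrow> v \<noteq> (\<lambda>c. 0) \<Longrightarrow> norm_wrt h p v > 0"
  by (simp add: norm_wrt_def metric_pos)

lemma vector_field_tangent: "smooth_vector_field A X \<Longrightarrow> X p \<in> tangent_space A p"
  by (simp add: smooth_vector_field_def)

definition dual_form ::
  "('g \<Rightarrow> ('g, 'n) tvec) \<Rightarrow> ('g, 'n) chart \<Rightarrow> real^'n \<Rightarrow> real^'n \<Rightarrow> real" where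
  "dual_form X c z u = gram c z (X (param c z) c) u"

lemma dual_form_eq:
  assumes "c \<in> A" "z \<in> image_of c" "smooth_vector_field A X"
  shows "dual_form X c z u = h (param c z) (X (param c z)) (coord_vec A c (param c z) u)"
  using tangent_eq_coord_vec[OF assms(1) inv_into_into[OF assms(2)] vector_field_tangent[OF assms(3)]]
  by (simp add: dual_form_def gram_def)

lemma dual_form_differentiable:
  assumes c: "c \<in> A" and x: "x \<in> image_of c" and X: "smooth_vector_field A X"
  shows "(\<lambda>z. dual_form X c z u) differentiable (at x)"
proof -
  have "(\<lambda>z. X (param c z) c) differentiable (at x)"
    using X c unfolding smooth_vector_field_def by (blast intro: smooth_on_differentiable[OF _ x])
  then have "(\<lambda>z. X (param c z) c $ i) differentiable (at x)" for i
    unfolding differentiable_def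
    using bounded_linear.has_derivative[OF bounded_linear_vec_nth] by blast
  then have "(\<lambda>z. \<Sum>i\<in>UNIV. X (param c z) c $ i *\<^sub>R gram c z (axis i 1) u) differentiable (at x)"
    by (intro differentiable_sum ballI differentiable_scaleR gram_differentiable[OF c x]) auto
  then obtain D where "((\<lambda>z. \<Sum>i\<in>UNIV. X (param c z) c $ i *\<^sub>R gram c z (axis i 1) u)
      has_derivative D) (at x)"
    unfolding differentiable_def by blast
  moreover have "open (image_of c)"
    using chart[OF c] by (simp add: is_chart_def)
  moreover have "(\<Sum>i\<in>UNIV. X (param c z) c $ i *\<^sub>R gram c z (axis i 1) u) = dual_form X c z u"
    if "z \<in> image_of c" for z
  proof -
    have "linear (\<lambda>v. gram c z v u)"
      using gram_bilinear[OF c that] by (simp add: bilinear_def)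
    from linear_axis_expansion[OF this] show ?thesis
      unfolding dual_form_def by (rule HOL.sym)
  qed
  ultimately have "((\<lambda>z. dual_form X c z u) has_derivative D) (at x)"
    by (rule has_derivative_transform_within_open[OF _ _ x])
  then show ?thesis unfolding differentiable_def by blast
qed

lemma randers_germ_in_chart:
  assumes c: "c \<in> A" and x: "x \<in> image_of c" and X: "smooth_vector_field A X"
    and small: "norm_wrt h (param c x) (X (param c x)) < 1"
  shows "randers_germ (image_of c) x (gram c)
    (\<lambda>w u v. frechet_derivative (\<lambda>z. gram c z u v) (at x) w)
    (dual_form X c) (\<lambda>w u. frechet_derivative (\<lambda>z. dual_form X c z u) (at x) w)
    (X (param c x) c) (local_rep A c (randers h X))"
proof (rule randers_germ.intro)
  show "open (image_of c)" using chart[OF c] by (simp add: is_chart_def)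
  show "x \<in> image_of c" by (rule x)
  show "bilinear (gram c z)" if "z \<in> image_of c" for z by (rule gram_bilinear[OF c that])
  show "gram c z u v = gram c z v u" if "z \<in> image_of c" for z u v by (rule gram_sym[OF c that])
  show "gram c x u u > 0" if "u \<noteq> 0" for u by (rule gram_pos[OF c x that])
  show "linear (dual_form X c z)" if "z \<in> image_of c" for z
    using gram_bilinear[OF c that] by (simp add: bilinear_def dual_form_def[abs_def])
  show "((\<lambda>z. gram c z u v) has_derivative frechet_derivative (\<lambda>z. gram c z u v) (at x)) (at x)" for u v
    using gram_differentiable[OF c x] frechet_derivative_works by blast
  show "((\<lambda>z. dual_form X c z u) has_derivative frechet_derivative (\<lambda>z. dual_form X c z u) (at x)) (at x)"
    for u
    using dual_form_differentiable[OF c x X] frechet_derivative_works by blast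
  show "dual_form X c x u = gram c x (X (param c x) c) u" for u by (rule dual_form_def)
  have "gram c x (X (param c x) c) (X (param c x) c) = h (param c x) (X (param c x)) (X (param c x))"
    using tangent_eq_coord_vec[OF c inv_into_into[OF x] vector_field_tangent[OF X]]
    by (simp add: gram_def)
  then show "gram c x (X (param c x) c) (X (param c x) c) < 1"
    using small by (simp add: norm_wrt_def)
  show "local_rep A c (randers h X) z u = sqrt (gram c z u u) + dual_form X c z u"
    if "z \<in> image_of c" for z u
    by (simp add: local_rep_def randers_def gram_def dual_form_eq[OF c that X])
qed

theorem randers_osculating_same_type:
  assumes X: "smooth_vector_field A X"
    and N: "N > 0" "\<And>p. norm_wrt h p (X p) = N" and N1: "N < 1"
    and osc: "\<And>p. norm_wrt (osc_metric h X) p (X p) < 1"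
  shows "douglas_type A (randers (osc_metric h X) X) \<longleftrightarrow> douglas_type A (randers h X)"
    and "berwald_type A (randers (osc_metric h X) X) \<longleftrightarrow> berwald_type A (randers h X)"
proof -
  have hN: "h p (X p) (X p) = N\<^sup>2" for p
    using N(1) N(2)[of p] unfolding norm_wrt_def by (metis less_imp_le real_sqrt_ge_0_iff real_sqrt_pow2)
  \<comment> \<open>As \<open>h p (X p) (X p) = N\<^sup>2\<close>, the length of \<open>X\<close> grows by the factor \<open>1 + N\<close>.\<close>
  have "((1 + N) * N)\<^sup>2 = osc_metric h X p (X p) (X p)" for p
    using N(1) by (simp add: osc_metric_def N(2) hN power2_eq_square field_simps)
  then have "norm_wrt (osc_metric h X) p (X p) = (1 + N) * N" for p
    using N(1) unfolding norm_wrt_def by (metis add_pos_pos mult_pos_pos real_sqrt_abs abs_of_pos zero_less_one)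
  with osc have small: "(1 + N) * N < 1" by metis
  have "(douglas_at (local_rep A c (randers (osc_metric h X) X)) x
        \<longleftrightarrow> douglas_at (local_rep A c (randers h X)) x) \<and>
      (berwald_at (local_rep A c (randers (osc_metric h X) X)) x
        \<longleftrightarrow> berwald_at (local_rep A c (randers h X)) x)"
    if c: "c \<in> A" and x: "x \<in> image_of c" for c x
  proof -
    let ?\<xi> = "X (param c x) c"
    interpret randers_germ "image_of c" x "gram c"
      "\<lambda>w u v. frechet_derivative (\<lambda>z. gram c z u v) (at x) w"
      "dual_form X c" "\<lambda>w u. frechet_derivative (\<lambda>z. dual_form X c z u) (at x) w"
      ?\<xi> "local_rep A c (randers h X)"
      by (rule randers_germ_in_chart[OF c x X]) (simp add: N(2) N1)
    have "gram c x ?\<xi> ?\<xi> = N\<^sup>2"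
      using tangent_eq_coord_vec[OF c inv_into_into[OF x] vector_field_tangent[OF X]]
      by (simp add: gram_def hN)
    moreover have "local_rep A c (randers (osc_metric h X) X) z u =
        sqrt ((1 + N) * (gram c z u u + 1 / N * dual_form X c z u * dual_form X c z u))
        + (1 + N)\<^sup>2 * dual_form X c z u" if z: "z \<in> image_of c" for z u
    proof -
      have "osc_metric h X (param c z) (X (param c z)) (coord_vec A c (param c z) u)
          = (1 + N)\<^sup>2 * dual_form X c z u"
        using N(1) by (simp add: osc_metric_def N(2) hN dual_form_eq[OF c z X] power2_eq_square field_simps)
      then show ?thesis
        by (simp add: local_rep_def randers_def osc_metric_def[of h X _ "coord_vec A c (param c z) u"]
            N(2) gram_def dual_form_eq[OF c z X])
    qed
    ultimately show ?thesis
      using osculating_same_type[OF N(1) _ small] by blast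
  qed
  then show "douglas_type A (randers (osc_metric h X) X) \<longleftrightarrow> douglas_type A (randers h X)"
    and "berwald_type A (randers (osc_metric h X) X) \<longleftrightarrow> berwald_type A (randers h X)"
    unfolding douglas_type_iff_pointwise berwald_type_iff_pointwise by simp_all
qed

end

section \<open>Left-invariant fields on a Lie group\<close>

text \<open>Left translations act transitively and preserve both the field and the metric.\<close>

lemma left_invariant_norm_constant:
  fixes G :: "'g::{t2_space, second_countable_topology} monoid"
    and A :: "('g, 'n::finite) chart set"
  assumes G: "lie_group G A" and h: "left_invariant_metric G A h" and X: "X \<in> lie_algebra G A"
  shows "norm_wrt h p (X p) = norm_wrt h q (X q)"
proof -
  interpret group G using G by (simp add: lie_group_def)
  have carrier: "a \<in> carrier G" for a using G by (simp add: lie_group_def)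
  \<comment> \<open>Left translation by \<open>?a\<close> takes \<open>q\<close> to \<open>p\<close>.\<close>
  let ?a = "p \<otimes>\<^bsub>G\<^esub> inv\<^bsub>G\<^esub> q"
  have a: "?a \<otimes>\<^bsub>G\<^esub> q = p" using carrier by (simp add: m_assoc)
  have "X q \<in> tangent_space A q" using X by (simp add: lie_algebra_def smooth_vector_field_def)
  then have "h (?a \<otimes>\<^bsub>G\<^esub> q) (differential A (\<lambda>r. ?a \<otimes>\<^bsub>G\<^esub> r) q (X q))
      (differential A (\<lambda>r. ?a \<otimes>\<^bsub>G\<^esub> r) q (X q)) = h q (X q) (X q)"
    using h unfolding left_invariant_metric_def by blast
  moreover have "differential A (\<lambda>r. ?a \<otimes>\<^bsub>G\<^esub> r) q (X q) = X (?a \<otimes>\<^bsub>G\<^esub> q)"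
    using X unfolding lie_algebra_def by blast
  ultimately show ?thesis by (simp add: a norm_wrt_def)
qed

theorem proposition3p1:
  fixes G :: "'g::{t2_space, second_countable_topology} monoid"
    and A :: "('g, 'n::finite) chart set"
    and h :: "'g \<Rightarrow> ('g, 'n) tvec \<Rightarrow> ('g, 'n) tvec \<Rightarrow> real"
    and X :: "'g \<Rightarrow> ('g, 'n) tvec"
  assumes "lie_group G A"
    and "riemannian_metric A h" and "left_invariant_metric G A h"
    and "X \<in> lie_algebra G A" and "X \<noteq> (\<lambda>p c. 0)"
    and "\<forall>p. norm_wrt h p (X p) < 1"
    and "\<forall>p. norm_wrt (osc_metric h X) p (X p) < 1"
  shows "(douglas_type A (randers h X) \<longleftrightarrow> douglas_type A (randers (osc_metric h X) X)) \<and>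
         (berwald_type A (randers h X) \<longleftrightarrow> berwald_type A (randers (osc_metric h X) X))"
proof -
  interpret riemannian_manifold A h
    by (intro riemannian_manifold.intro smooth_manifold.intro riemannian_manifold_axioms.intro)
       (use assms(1,2) in \<open>simp_all add: lie_group_def\<close>)
  have X: "smooth_vector_field A X" using assms(4) by (simp add: lie_algebra_def)
  obtain p where "X p \<noteq> (\<lambda>c. 0)" using assms(5) by blast
  then have pos: "norm_wrt h p (X p) > 0"
    by (rule norm_wrt_pos[OF vector_field_tangent[OF X]])
  have const: "norm_wrt h q (X q) = norm_wrt h p (X p)" for q
    by (rule left_invariant_norm_constant[OF assms(1,3,4)])
  have "norm_wrt h p (X p) < 1" and osc: "norm_wrt (osc_metric h X) q (X q) < 1" for q
    using assms(6,7) by blast+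
  with randers_osculating_same_type[OF X pos const _ osc] show ?thesis
    by blast
qed

end
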